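(* Let $0<\delta<1$ and let $\sigma$ be the probability measure on $[-1,1]$ with density $\rho(\sigma;\beta)=\frac12\chi_{[-1,1]}(\beta)$ with respect to Lebesgue measure. Let $\mu$ be the invariant measure of the affine homogeneous iterated function system with contraction ratio $\delta$ and distribution of fixed points $\sigma$. Then $\mu$ is absolutely continuous with respect to Lebesgue measure, with a density $\rho(\mu;x)$ (a function of $x\in\mathbb{R}$) that is infinitely differentiable and not (real-)analytic.
   Context: Let $0<\delta<1$, $\bar\delta:=1-\delta$, and let $\sigma$ be a Borel probability measure on $[-1,1]$. The affine homogeneous iterated function system with contraction ratio $\delta$ and distribution of fixed points $\sigma$ is the family of maps $\phi_{\delta,\beta}(x)=\delta(x-\beta)+\beta=\delta x+\bar\delta\beta$ of $[-1,1]$ into itself, with $\beta$ chosen at random with law $\sigma$. Its transfer operator on continuous functions on $[-1,1]$ is $(Tf)(x)=\int f(\delta x+\bar\delta\beta)\,d\sigma(\beta)$, and $T^*$ is the adjoint acting on Borel measures, $\int f\,d(T^*\mu)=\int Tf\,d\mu$. The invariant measure is the unique Borel probability measure $\mu$ on $[-1,1]$ with $T^*\mu=\mu$ (existence and uniqueness are known). Measures on $[-1,1]$ and their densities are regarded as defined on $\mathbb{R}$, vanishing outside $[-1,1]$. $\chi_A$ denotes the characteristic function of $A$. *)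

theory Defs
  imports "HOL-Probability.Probability"
begin

text \<open>
  A measure on \<open>[-1, 1]\<close> is a Borel measure on the real line that is concentrated on \<open>[-1, 1]\<close>.
  A function on \<open>[-1, 1]\<close> is a total function on the reals whose values outside \<open>[-1, 1]\<close> are
  irrelevant; this is why the integrals below are taken over \<open>{-1..1}\<close>.
\<close>

definition prob_measure_on_interval :: "real measure \<Rightarrow> bool" where
  "prob_measure_on_interval \<mu> \<longleftrightarrow>
     prob_space \<mu> \<and> sets \<mu> = sets borel \<and> emeasure \<mu> {-1..1} = 1"

definition ifs_map :: "real \<Rightarrow> real \<Rightarrow> real \<Rightarrow> real" where
  "ifs_map \<delta> \<beta> x = \<delta> * (x - \<beta>) + \<beta>"

definition transfer_operator :: "real \<Rightarrow> real measure \<Rightarrow> (real \<Rightarrow> real) \<Rightarrow> real \<Rightarrow> real" where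
  "transfer_operator \<delta> \<sigma> f x = (LINT \<beta>:{-1..1}|\<sigma>. f (ifs_map \<delta> \<beta> x))"

text \<open>The relation \<open>\<nu> = T\<^sup>* \<mu>\<close>, where \<open>T\<^sup>*\<close> is the adjoint of the transfer operator.\<close>

definition is_adjoint_transfer ::
    "real \<Rightarrow> real measure \<Rightarrow> real measure \<Rightarrow> real measure \<Rightarrow> bool" where
  "is_adjoint_transfer \<delta> \<sigma> \<mu> \<nu> \<longleftrightarrow>
     (\<forall>f. continuous_on {-1..1} f \<longrightarrow>
        (LINT x:{-1..1}|\<nu>. f x) = (LINT x:{-1..1}|\<mu>. transfer_operator \<delta> \<sigma> f x))"

definition is_invariant_measure :: "real \<Rightarrow> real measure \<Rightarrow> real measure \<Rightarrow> bool" where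
  "is_invariant_measure \<delta> \<sigma> \<mu> \<longleftrightarrow>
     prob_measure_on_interval \<mu> \<and> is_adjoint_transfer \<delta> \<sigma> \<mu> \<mu>"

definition infinitely_differentiable :: "(real \<Rightarrow> real) \<Rightarrow> bool" where
  "infinitely_differentiable f \<longleftrightarrow> (\<forall>n. (deriv ^^ n) f differentiable_on UNIV)"

definition real_analytic :: "(real \<Rightarrow> real) \<Rightarrow> bool" where
  "real_analytic f \<longleftrightarrow> (\<forall>x. \<exists>F. (\<lambda>h. f (x + h)) has_fps_expansion F)"

end

theory Submission
  imports Defs "HOL-Complex_Analysis.Cauchy_Integral_Formula"
begin

text \<open>
  Invariance says that \<open>\<mu>\<close> is the law of \<open>\<delta>X + (1 - \<delta>)B\<close> for independent \<open>X\<close> and \<open>B\<close> with laws \<open>\<mu>\<close>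
  and \<open>\<sigma>\<close> (lemma \<open>invariant_eq_distr\<close>). Since \<open>B\<close> is uniform on \<open>[-1, 1]\<close>, convolution turns \<open>\<mu>\<close>
  into its own average over a window (lemma \<open>invariant_eq_density_window\<close>): \<open>\<mu>\<close> has the density
  \<open>\<rho>(y) = \<mu>[(y - (1 - \<delta>)) / \<delta>, (y + (1 - \<delta>)) / \<delta>] / (2 (1 - \<delta>))\<close>.

  Having a density, \<open>\<mu>\<close> has no atoms, so its distribution function \<open>F\<close> is continuous and \<open>\<rho>\<close>, a
  multiple of the difference of two rescaled copies of \<open>F\<close>, is continuous too. Hence \<open>F' = \<rho>\<close> everywhere, which is
  the functional differential equation \<open>F'(y) = c (F(ay + b) - F(ay - b))\<close>. Its right-hand side is
  as often differentiable as \<open>F\<close>, so \<open>F\<close> gains one derivative after the other (lemma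
  \<open>higher_deriv_two_point_equation\<close>) and \<open>F\<close> and \<open>\<rho>\<close> are smooth.

  For \<open>\<bar>y\<bar> > 1\<close> the window misses \<open>[-1, 1]\<close>, hence \<open>\<rho>\<close> vanishes there. An analytic function that
  vanishes on a half-line vanishes everywhere (lemma \<open>real_analytic_zero_right_half_line\<close>), but
  \<open>\<rho>\<close> is the density of a probability measure.
\<close>

section \<open>Functional differential equations with two rescaled arguments\<close>

text \<open>
  Differentiating the equation yields an equation of the same shape for the derivative, with \<open>c\<close>
  replaced by \<open>c * a\<close>. Stating the equation for every iterated derivative, rather than just
  differentiability, is what makes the induction go through.
\<close>

lemma higher_deriv_two_point_equation:
  fixes F :: "real \<Rightarrow> real"
  assumes F': "\<And>y. (F has_real_derivative c * (F (a * y + b) - F (a * y - b))) (at y)"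
  shows "((deriv ^^ n) F has_real_derivative
           c * a ^ n * ((deriv ^^ n) F (a * y + b) - (deriv ^^ n) F (a * y - b))) (at y)"
proof (induction n arbitrary: y)
  case 0
  then show ?case using F' by simp
next
  case (Suc n)
  define D where "D = (deriv ^^ n) F"
  have D': "(D has_real_derivative c * a ^ n * (D (a * x + b) - D (a * x - b))) (at x)" for x
    using Suc unfolding D_def .
  have DS: "(deriv ^^ Suc n) F = (\<lambda>x. c * a ^ n * (D (a * x + b) - D (a * x - b)))"
    using DERIV_imp_deriv[OF D'] by (auto simp: D_def)
  have D'': "(D has_real_derivative (deriv ^^ Suc n) F x) (at x)" for x
    using D' unfolding DS .
  have "((\<lambda>x. c * a ^ n * (D (a * x + b) - D (a * x - b))) has_real_derivative
     c * a ^ n * ((deriv ^^ Suc n) F (a * y + b) * a - (deriv ^^ Suc n) F (a * y - b) * a)) (at y)"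
    by (intro DERIV_cmult DERIV_diff DERIV_chain2[OF D''])
       (auto intro!: derivative_eq_intros)
  then show ?case
    unfolding DS[symmetric] by (simp add: algebra_simps)
qed

section \<open>Analytic functions vanishing on a half-line\<close>

text \<open>
  Suppose that the largest right half-line on which \<open>f\<close> vanishes has an end point \<open>s\<close>. By isolation
  of zeros, the power series of \<open>f\<close> at \<open>s\<close> is zero, so \<open>f\<close> also vanishes a little to the left of
  \<open>s\<close>, which is absurd.
\<close>

lemma real_analytic_zero_right_half_line:
  fixes f :: "real \<Rightarrow> real"
  assumes an: "real_analytic f" and zero: "\<And>x. x > t \<Longrightarrow> f x = 0"
  shows "f x = 0"
proof -
  define S where "S = {t. \<forall>x>t. f x = 0}"
  have t: "t \<in> S" using zero by (auto simp: S_def)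
  show ?thesis
  proof (cases "bdd_below S")
    case False
    then obtain u where "u \<in> S" "u < x"
      unfolding bdd_below_def by (meson not_le)
    then show ?thesis by (auto simp: S_def)
  next
    case True
    define s where "s = Inf S"
    have right: "f y = 0" if y: "y > s" for y
    proof -
      obtain u where "u \<in> S" "u < y"
        using y t cInf_lessD[of S y] unfolding s_def by blast
      then show ?thesis by (auto simp: S_def)
    qed
    obtain A where A: "(\<lambda>h. f (s + h)) has_fps_expansion A"
      using an unfolding real_analytic_def by blast
    then obtain r where r: "r > 0" "\<And>h. \<bar>h\<bar> < r \<Longrightarrow> eval_fps A h = f (s + h)"
      by (auto simp: has_fps_expansion_def eventually_nhds_metric dist_norm)
    \<comment> \<open>The sum \<open>eval_fps A\<close> is meaningful only where the series converges, so \<open>r\<close> may exceed the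
      radius of convergence, which in turn may be infinite.\<close>
    obtain r' where r': "r' > 0" "r' \<le> r" "ereal r' \<le> fps_conv_radius A"
    proof (cases "fps_conv_radius A")
      case (real q)
      then show ?thesis using A r(1) that[of "min r q"] by (auto simp: has_fps_expansion_def)
    qed (use A r(1) that in \<open>auto simp: has_fps_expansion_def\<close>)
    have sums: "(\<lambda>n. fps_nth A n * (h - 0) ^ n) sums f (s + h)" if "norm (h - 0) < r'" for h
    proof -
      have "\<bar>h\<bar> < r" "ereal (norm h) < fps_conv_radius A"
        using that r' by (auto intro: less_le_trans[of _ "ereal r'"])
      then show ?thesis using sums_eval_fps[of h A] r(2)[of h] by simp
    qed
    have f0: "f (s + 0) = 0"
    proof -
      have "isCont (\<lambda>h. f (s + h)) 0"
        using has_fps_expansion_imp_continuous[OF A, of UNIV] by simp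
      then have "((\<lambda>h. f (s + h)) \<longlongrightarrow> f (s + 0)) (at_right 0)"
        by (simp add: isCont_def filterlim_at_split)
      moreover have "((\<lambda>h. f (s + h)) \<longlongrightarrow> 0) (at_right 0)"
        by (rule tendsto_eventually) (auto simp: eventually_at_filter right)
      ultimately show ?thesis
        using tendsto_unique trivial_limit_at_right_real by blast
    qed
    have A0: "fps_nth A m = 0" for m
    proof (rule ccontr)
      assume m: "fps_nth A m \<noteq> 0"
      have "fps_nth A 0 = 0"
        using r(2)[of 0] r(1) f0 by (simp add: eval_fps_at_0)
      with m have "m > 0" by (cases m) auto
      from powser_0_nonzero[where f = "\<lambda>h. f (s + h)" and \<xi> = 0, OF r'(1) sums f0 m this]
      obtain e where "0 < e" "\<And>z. z \<in> cball 0 e - {0} \<Longrightarrow> f (s + z) \<noteq> 0"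
        by metis
      from this(2)[of e] this(1) right[of "s + e"] show False by simp
    qed
    have near: "f y = 0" if "y > s - r" for y
    proof (cases "y > s")
      case False
      with that show ?thesis
        using r(2)[of "y - s"] by (simp add: eval_fps_def A0)
    qed (rule right)
    have "s - r \<in> S"
      using near by (auto simp: S_def)
    then have "s \<le> s - r"
      unfolding s_def by (rule cInf_lower) (rule True)
    with r(1) show ?thesis by simp
  qed
qed

section \<open>The invariant measure as the law of a random sum\<close>

lemma real_distribution_on_interval:
  assumes "prob_measure_on_interval \<nu>" shows "real_distribution \<nu>"
  using assms sets_eq_imp_space_eq[of \<nu> borel]
  unfolding prob_measure_on_interval_def real_distribution_def real_distribution_axioms_def by auto

lemma AE_in_interval:
  assumes "prob_measure_on_interval \<nu>" shows "AE x in \<nu>. x \<in> {-1..1}"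
proof -
  interpret prob_space \<nu> using assms by (simp add: prob_measure_on_interval_def)
  have "prob {-1..1} = 1" 
    using assms by (simp add: prob_measure_on_interval_def emeasure_eq_measure)
  then show ?thesis 
    using prob_eq_1[of "{-1..1}"] assms by (auto simp: prob_measure_on_interval_def)
qed

lemma set_integral_interval:
  fixes f :: "real \<Rightarrow> real"
  assumes "prob_measure_on_interval \<nu>" and [measurable]: "f \<in> borel_measurable borel"
  shows "(LINT x:{-1..1}|\<nu>. f x) = (\<integral>x. f x \<partial>\<nu>)"
proof -
  have [measurable_cong]: "sets \<nu> = sets borel" 
    using assms by (simp add: prob_measure_on_interval_def)
  show ?thesis
    unfolding set_lebesgue_integral_def
    by (rule integral_cong_AE) (use AE_in_interval[OF assms(1)] in auto)
qed

text \<open>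
  Both measures are concentrated on \<open>[-1, 1]\<close>, so the restricted integrals of the adjoint relation
  become integrals over the line, which fit product measures and characteristic functions.
\<close>

lemma integral_invariant:
  fixes f :: "real \<Rightarrow> real"
  assumes \<sigma>: "prob_measure_on_interval \<sigma>" and inv: "is_invariant_measure \<delta> \<sigma> \<mu>"
    and f: "continuous_on UNIV f"
  shows "(\<integral>x. f x \<partial>\<mu>) = (\<integral>x. \<integral>b. f (\<delta> * x + (1 - \<delta>) * b) \<partial>\<sigma> \<partial>\<mu>)"
proof -
  interpret S: real_distribution \<sigma> by (rule real_distribution_on_interval[OF \<sigma>])
  have [measurable]: "f \<in> borel_measurable borel"
    by (rule borel_measurable_continuous_onI[OF f])
  have \<mu>: "prob_measure_on_interval \<mu>"
    using inv by (simp add: is_invariant_measure_def)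
  have "(\<integral>x. f x \<partial>\<mu>) = (LINT x:{-1..1}|\<mu>. f x)"
    by (rule set_integral_interval[OF \<mu>, symmetric]) simp
  also have "\<dots> = (LINT x:{-1..1}|\<mu>. transfer_operator \<delta> \<sigma> f x)"
    using inv continuous_on_subset[OF f]
    unfolding is_invariant_measure_def is_adjoint_transfer_def by blast
  also have "transfer_operator \<delta> \<sigma> f = (\<lambda>x. \<integral>b. f (\<delta> * x + (1 - \<delta>) * b) \<partial>\<sigma>)"
    unfolding transfer_operator_def ifs_map_def
    by (subst set_integral_interval[OF \<sigma>]) (auto simp: algebra_simps)
  also have "(LINT x:{-1..1}|\<mu>. \<integral>b. f (\<delta> * x + (1 - \<delta>) * b) \<partial>\<sigma>)
      = (\<integral>x. \<integral>b. f (\<delta> * x + (1 - \<delta>) * b) \<partial>\<sigma> \<partial>\<mu>)"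
    by (rule set_integral_interval[OF \<mu>]) measurable
  finally show ?thesis .
qed

text \<open>
  The adjoint relation only concerns continuous test functions. The choices \<open>cos (t x)\<close> and
  \<open>sin (t x)\<close> are enough: they give equality of the characteristic functions, and Levy's uniqueness
  theorem upgrades it to equality of the measures.
\<close>

lemma invariant_eq_distr:
  assumes \<sigma>: "prob_measure_on_interval \<sigma>" and inv: "is_invariant_measure \<delta> \<sigma> \<mu>"
  shows "\<mu> = distr (\<mu> \<Otimes>\<^sub>M \<sigma>) borel (\<lambda>(x, b). \<delta> * x + (1 - \<delta>) * b)"
    (is "_ = ?N")
proof -
  interpret S: real_distribution \<sigma> by (rule real_distribution_on_interval[OF \<sigma>])
  interpret M: real_distribution \<mu>
    using inv by (simp add: is_invariant_measure_def real_distribution_on_interval)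
  interpret P: pair_prob_space \<mu> \<sigma> ..
  interpret N: real_distribution ?N
    by (intro real_distribution.intro P.prob_space_distr real_distribution_axioms.intro) simp_all
  have same: "(\<integral>x. f x \<partial>\<mu>) = (\<integral>x. f x \<partial>?N)"
    if f: "continuous_on UNIV f" and bd: "\<And>x. \<bar>f x\<bar> \<le> 1" for f :: "real \<Rightarrow> real"
  proof -
    have [measurable]: "f \<in> borel_measurable borel"
      by (rule borel_measurable_continuous_onI[OF f])
    have "integrable (\<mu> \<Otimes>\<^sub>M \<sigma>) (\<lambda>(x, b). f (\<delta> * x + (1 - \<delta>) * b))"
      by (rule P.integrable_const_bound[of _ 1]) (auto simp: bd)
    from P.integral_fst[OF this] show ?thesis
      by (simp add: integral_invariant[OF \<sigma> inv f] integral_distr split_beta split_beta')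
  qed
  have "char \<mu> t = char ?N t" for t
  proof (rule complex_eqI)
    have i: "integrable \<mu> (\<lambda>x. iexp (t * x))" "integrable ?N (\<lambda>x. iexp (t * x))"
      by (rule M.integrable_iexp N.integrable_iexp; simp)+
    have "(\<integral>x. cos (t * x) \<partial>\<mu>) = (\<integral>x. cos (t * x) \<partial>?N)"
      by (intro same continuous_intros) simp
    then show "Re (char \<mu> t) = Re (char ?N t)"
      unfolding char_def integral_Re[OF i(1), symmetric] integral_Re[OF i(2), symmetric]
      by (simp add: Re_exp)
    have "(\<integral>x. sin (t * x) \<partial>\<mu>) = (\<integral>x. sin (t * x) \<partial>?N)"
      by (intro same continuous_intros) simp
    then show "Im (char \<mu> t) = Im (char ?N t)"
      unfolding char_def integral_Im[OF i(1), symmetric] integral_Im[OF i(2), symmetric]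
      by (simp add: Im_exp)
  qed
  then show ?thesis
    by (intro Levy_uniqueness M.real_distribution_axioms N.real_distribution_axioms) auto
qed

section \<open>The density as a window average\<close>

lemma prob_measure_on_interval_uniform:
  "prob_measure_on_interval (density lborel (\<lambda>\<beta>. ennreal (1 / 2 * indicator {-1..1} \<beta>)))"
    (is "prob_measure_on_interval ?U")
proof -
  have e: "emeasure ?U A = 1" if "A \<in> sets borel" "{-1..1} \<subseteq> A" for A
  proof -
    have "emeasure ?U A = (\<integral>\<^sup>+\<beta>. ennreal (1 / 2 * indicator {-1..1} \<beta>) * indicator A \<beta> \<partial>lborel)"
      using that by (subst emeasure_density) auto
    also have "\<dots> = (\<integral>\<^sup>+(\<beta>::real). ennreal (1 / 2) * indicator {-1..1} \<beta> \<partial>lborel)"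
      using that(2) by (intro nn_integral_cong) (auto split: split_indicator)
    also have "\<dots> = 1"
      using ennreal_mult'[of "1 / 2" 2] by (simp add: nn_integral_cmult_indicator)
    finally show ?thesis .
  qed
  then show ?thesis
    by (auto simp: prob_measure_on_interval_def intro!: prob_spaceI)
qed

text \<open>
  The density of \<open>\<delta>X + (1 - \<delta>)B\<close> for \<open>X\<close> with law \<open>\<mu>\<close> and \<open>B\<close> uniform on \<open>[-1, 1]\<close>: given \<open>X = x\<close>,
  the sum is uniform on the interval of radius \<open>1 - \<delta>\<close> around \<open>\<delta>x\<close>, and the window consists of those
  \<open>x\<close> for which \<open>y\<close> lies in this interval.
\<close>

definition window_density :: "real \<Rightarrow> real measure \<Rightarrow> real \<Rightarrow> real" where
  "window_density \<delta> \<mu> y =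
     measure \<mu> {(y - (1 - \<delta>)) / \<delta> .. (y + (1 - \<delta>)) / \<delta>} / (2 * (1 - \<delta>))"

text \<open>
  Substituting \<open>y = \<delta>x + (1 - \<delta>)b\<close> in the inner integral of \<open>invariant_eq_distr\<close> and exchanging the
  order of integration by Tonelli's theorem leaves, for each \<open>y\<close>, the \<open>\<mu>\<close>-measure of the window.
\<close>

lemma invariant_eq_density_window:
  fixes \<delta> :: real
  assumes \<delta>: "0 < \<delta>" "\<delta> < 1"
    and \<sigma>: "\<sigma> = density lborel (\<lambda>\<beta>. ennreal (1 / 2 * indicator {-1..1} \<beta>))"
    and inv: "is_invariant_measure \<delta> \<sigma> \<mu>"
  shows "window_density \<delta> \<mu> \<in> borel_measurable borel"
    and "\<mu> = density lborel (\<lambda>y. ennreal (window_density \<delta> \<mu> y))"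
proof -
  define d where "d = 1 - \<delta>"
  have d: "d > 0" using \<delta> by (simp add: d_def)
  have \<sigma>_on: "prob_measure_on_interval \<sigma>"
    unfolding \<sigma> by (rule prob_measure_on_interval_uniform)
  interpret S: real_distribution \<sigma> by (rule real_distribution_on_interval[OF \<sigma>_on])
  interpret M: real_distribution \<mu>
    using inv by (simp add: is_invariant_measure_def real_distribution_on_interval)
  interpret P: pair_sigma_finite \<mu> lborel ..
  have win: "\<bar>y - \<delta> * x\<bar> \<le> d \<longleftrightarrow> x \<in> {(y - d) / \<delta> .. (y + d) / \<delta>}" for x y
    using \<delta> by (auto simp: field_simps abs_le_iff)
  have win_meas: "window_density \<delta> \<mu> y = measure \<mu> {x \<in> space \<mu>. \<bar>y - \<delta> * x\<bar> \<le> d} / (2 * d)" for y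
    unfolding window_density_def win d_def[symmetric]
    by (auto intro!: arg_cong2[where f = "(/)"] arg_cong[where f = "measure \<mu>"])
  show meas: "window_density \<delta> \<mu> \<in> borel_measurable borel"
    unfolding win_meas by measurable
  show "\<mu> = density lborel (\<lambda>y. ennreal (window_density \<delta> \<mu> y))"
  proof (rule measure_eqI)
    fix A assume "A \<in> sets \<mu>"
    then have A[measurable]: "A \<in> sets borel" by simp
    \<comment> \<open>The conditional density of the sum at \<open>y\<close> given \<open>X = x\<close>, restricted to \<open>A\<close>.\<close>
    define g where "g x y = ennreal (if \<bar>y - \<delta> * x\<bar> \<le> d then 1 / (2 * d) else 0) * indicator A y"
      for x y
    have g[measurable]: "case_prod g \<in> borel_measurable (\<mu> \<Otimes>\<^sub>M lborel)"
      unfolding g_def by measurable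
    have "emeasure \<mu> A = emeasure (distr (\<mu> \<Otimes>\<^sub>M \<sigma>) borel (\<lambda>(x, b). \<delta> * x + d * b)) A"
      using invariant_eq_distr[OF \<sigma>_on inv] unfolding d_def by simp
    also have "\<dots> = (\<integral>\<^sup>+z. indicator A (case z of (x, b) \<Rightarrow> \<delta> * x + d * b) \<partial>(\<mu> \<Otimes>\<^sub>M \<sigma>))"
      by (subst nn_integral_indicator[symmetric], simp, subst nn_integral_distr) auto
    also have "\<dots> = (\<integral>\<^sup>+x. \<integral>\<^sup>+b. indicator A (\<delta> * x + d * b) \<partial>\<sigma> \<partial>\<mu>)"
      by (subst S.nn_integral_fst[symmetric]) auto
    also have "\<dots> = (\<integral>\<^sup>+x. \<integral>\<^sup>+y. g x y \<partial>lborel \<partial>\<mu>)"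
    proof (rule nn_integral_cong)
      fix x
      have gx[measurable]: "g x \<in> borel_measurable borel"
        unfolding g_def by measurable
      have "(\<integral>\<^sup>+y. g x y \<partial>lborel) = (\<integral>\<^sup>+b. ennreal d * g x (\<delta> * x + d * b) \<partial>lborel)"
        using d by (subst nn_integral_real_affine[where c = d and t = "\<delta> * x"])
          (auto simp: nn_integral_cmult)
      also have "\<dots> = (\<integral>\<^sup>+b. ennreal (1 / 2 * indicator {-1..1} b) * indicator A (\<delta> * x + d * b) \<partial>lborel)"
      proof (rule nn_integral_cong)
        fix b
        have "\<bar>d * b\<bar> \<le> d \<longleftrightarrow> b \<in> {-1..1}"
          using d by (auto simp: abs_mult abs_le_iff)
        then show "ennreal d * g x (\<delta> * x + d * b) =
            ennreal (1 / 2 * indicator {-1..1} b) * indicator A (\<delta> * x + d * b)"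
          using d unfolding g_def mult.assoc[symmetric]
          by (subst ennreal_mult'[symmetric]) (auto split: split_indicator)
      qed
      also have "\<dots> = (\<integral>\<^sup>+b. indicator A (\<delta> * x + d * b) \<partial>\<sigma>)"
        unfolding \<sigma> by (subst nn_integral_density) auto
      finally show "(\<integral>\<^sup>+b. indicator A (\<delta> * x + d * b) \<partial>\<sigma>) = (\<integral>\<^sup>+y. g x y \<partial>lborel)" ..
    qed
    also have "\<dots> = (\<integral>\<^sup>+y. \<integral>\<^sup>+x. g x y \<partial>\<mu> \<partial>lborel)"
      by (rule P.Fubini'[OF g, symmetric])
    also have "\<dots> = (\<integral>\<^sup>+y. ennreal (window_density \<delta> \<mu> y) * indicator A y \<partial>lborel)"
    proof (rule nn_integral_cong)
      fix y
      have "(\<integral>\<^sup>+x. g x y \<partial>\<mu>) = (\<integral>\<^sup>+x. ennreal (1 / (2 * d)) * indicator A y *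
          indicator {(y - d) / \<delta> .. (y + d) / \<delta>} x \<partial>\<mu>)"
        unfolding g_def win by (intro nn_integral_cong) (auto split: split_indicator)
      also have "\<dots> = ennreal (1 / (2 * d)) * indicator A y * emeasure \<mu> {(y - d) / \<delta> .. (y + d) / \<delta>}"
        by (simp add: nn_integral_cmult_indicator)
      also have "\<dots> = ennreal (1 / (2 * d)) * emeasure \<mu> {(y - d) / \<delta> .. (y + d) / \<delta>} * indicator A y"
        by (simp add: ac_simps)
      also have "\<dots> = ennreal (window_density \<delta> \<mu> y) * indicator A y"
        using d unfolding window_density_def M.emeasure_eq_measure d_def[symmetric]
        by (subst ennreal_mult'[symmetric]) auto
      finally show "(\<integral>\<^sup>+x. g x y \<partial>\<mu>) = ennreal (window_density \<delta> \<mu> y) * indicator A y" .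
    qed
    also have "\<dots> = emeasure (density lborel (\<lambda>y. ennreal (window_density \<delta> \<mu> y))) A"
      using meas by (subst emeasure_density) auto
    finally show "emeasure \<mu> A = emeasure (density lborel (\<lambda>y. ennreal (window_density \<delta> \<mu> y))) A" .
  qed simp
qed

section \<open>Smoothness of the density\<close>

lemma has_real_derivative_cdf_of_continuous_density:
  fixes f :: "real \<Rightarrow> real"
  assumes M: "real_distribution M" and dens: "M = density lborel (\<lambda>x. ennreal (f x))"
    and cont: "continuous_on UNIV f" and nonneg: "\<And>x. 0 \<le> f x"
  shows "(cdf M has_real_derivative f y) (at y)"
proof -
  interpret M: real_distribution M by (rule M)
  have [measurable]: "f \<in> borel_measurable borel"
    by (rule borel_measurable_continuous_onI[OF cont])
  \<comment> \<open>Any base point strictly to the left of \<open>y\<close> serves for the fundamental theorem of calculus.\<close>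
  define a where "a = y - 1"
  have cdf: "cdf M x = cdf M a + integral {a..x} f" if "a < x" for x
  proof -
    have i: "set_integrable lborel {a..x} f"
      by (rule borel_integrable_atLeastAtMost') (rule continuous_on_subset[OF cont], simp)
    have "emeasure M {a<..x} = (\<integral>\<^sup>+z. ennreal (indicator {a..x} z *\<^sub>R f z) \<partial>lborel)"
      unfolding dens
      by (subst emeasure_density)
         (auto intro!: nn_integral_cong_AE eventually_mono[OF AE_lborel_singleton[of a]]
           simp: less_le split: split_indicator)
    also have "\<dots> = ennreal (LINT z:{a..x}|lborel. f z)"
      unfolding set_lebesgue_integral_def using i nonneg
      by (intro nn_integral_eq_integral) (auto simp: set_integrable_def)
    also have "(LINT z:{a..x}|lborel. f z) = integral {a..x} f"
      by (rule set_borel_integral_eq_integral[OF i])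
    finally have "measure M {a<..x} = integral {a..x} f"
      using nonneg by (simp add: measure_def integral_nonneg set_borel_integral_eq_integral[OF i])
    with M.cdf_diff_eq[OF that] show ?thesis by simp
  qed
  have "((\<lambda>x. integral {a..x} f) has_real_derivative f y) (at y within {a..y + 1})"
    by (rule integral_has_real_derivative) (auto simp: a_def intro: continuous_on_subset[OF cont])
  then have "((\<lambda>x. integral {a..x} f) has_real_derivative f y) (at y)"
    by (subst (asm) at_within_interior) (auto simp: a_def)
  then have "((\<lambda>x. cdf M a + integral {a..x} f) has_real_derivative f y) (at y)"
    by (auto intro!: derivative_eq_intros)
  then show ?thesis
    by (rule has_field_derivative_transform_within_open[where S = "{a<..}"])
       (auto simp: a_def cdf)
qed

text \<open>
  Once \<open>\<mu>\<close> is known to have some density, it has no atoms; this makes the closed window's measure a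
  difference of values of the distribution function, and makes that function continuous, which
  starts the regularity bootstrap.
\<close>

lemma smooth_window_density:
  fixes \<delta> :: real
  assumes \<delta>: "0 < \<delta>" "\<delta> < 1" and M: "real_distribution \<mu>"
    and dens: "\<mu> = density lborel (\<lambda>y. ennreal (window_density \<delta> \<mu> y))"
    and [measurable]: "window_density \<delta> \<mu> \<in> borel_measurable borel"
  shows "infinitely_differentiable (window_density \<delta> \<mu>)"
proof -
  interpret M: real_distribution \<mu> by (rule M)
  define a b c where "a = 1 / \<delta>" and "b = (1 - \<delta>) / \<delta>" and "c = 1 / (2 * (1 - \<delta>))"
  have atomless: "measure \<mu> {x} = 0" for x
  proof -
    have "emeasure \<mu> {x} = (\<integral>\<^sup>+y. ennreal (window_density \<delta> \<mu> y) * indicator {x} y \<partial>lborel)"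
      by (subst dens, subst emeasure_density) auto
    also have "\<dots> = (\<integral>\<^sup>+(y::real). 0 \<partial>lborel)"
      by (intro nn_integral_cong_AE eventually_mono[OF AE_lborel_singleton[of x]]) auto
    finally show ?thesis by (simp add: measure_def)
  qed
  have window: "window_density \<delta> \<mu> = (\<lambda>y. c * (cdf \<mu> (a * y + b) - cdf \<mu> (a * y - b)))"
  proof
    fix y
    have le: "a * y - b < a * y + b" using \<delta> by (simp add: b_def)
    have "measure \<mu> {a * y - b..a * y + b} = measure \<mu> ({a * y - b} \<union> {a * y - b<..a * y + b})"
      using le by (intro arg_cong[where f = "measure \<mu>"]) auto
    also have "\<dots> = cdf \<mu> (a * y + b) - cdf \<mu> (a * y - b)"
      using M.cdf_diff_eq[OF le] atomless by (subst M.finite_measure_Union) auto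
    also have "{a * y - b..a * y + b} = {(y - (1 - \<delta>)) / \<delta> .. (y + (1 - \<delta>)) / \<delta>}"
      by (simp add: a_def b_def add_divide_distrib diff_divide_distrib)
    finally show "window_density \<delta> \<mu> y = c * (cdf \<mu> (a * y + b) - cdf \<mu> (a * y - b))"
      by (simp add: window_density_def c_def)
  qed
  have "continuous_on UNIV (cdf \<mu>)"
    using M.isCont_cdf atomless by (simp add: continuous_on_eq_continuous_at)
  then have "continuous_on UNIV (window_density \<delta> \<mu>)"
    unfolding window
    by (intro continuous_intros) (auto intro!: continuous_on_compose2[of UNIV "cdf \<mu>"] continuous_intros)
  then have F': "(cdf \<mu> has_real_derivative window_density \<delta> \<mu> y) (at y)" for y
    using \<delta> by (intro has_real_derivative_cdf_of_continuous_density[OF M dens])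
      (auto simp: window_density_def)
  then have "deriv (cdf \<mu>) = window_density \<delta> \<mu>"
    by (auto intro: DERIV_imp_deriv)
  then have iter: "(deriv ^^ n) (window_density \<delta> \<mu>) = (deriv ^^ Suc n) (cdf \<mu>)" for n
    by (simp only: funpow_Suc_right o_apply)
  have "(deriv ^^ n) (cdf \<mu>) differentiable_on UNIV" for n
    using higher_deriv_two_point_equation[of "cdf \<mu>" c a b n] F'
    unfolding window differentiable_on_def real_differentiable_def by auto
  then show ?thesis
    unfolding infinitely_differentiable_def iter by blast
qed

section \<open>Support of the density and failure of analyticity\<close>

text \<open>
  The maps contract \<open>[-1, 1]\<close> into itself: for \<open>y > 1\<close> the left end of the window exceeds
  \<open>(1 - (1 - \<delta>)) / \<delta> = 1\<close>, and symmetrically for \<open>y < -1\<close>.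
\<close>

lemma window_density_outside:
  assumes \<delta>: "0 < \<delta>" "\<delta> < 1" and \<mu>: "prob_measure_on_interval \<mu>" and y: "y \<notin> {-1..1}"
  shows "window_density \<delta> \<mu> y = 0"
proof -
  interpret prob_space \<mu> using \<mu> by (simp add: prob_measure_on_interval_def)
  let ?W = "{(y - (1 - \<delta>)) / \<delta> .. (y + (1 - \<delta>)) / \<delta>}"
  have "1 < (y - (1 - \<delta>)) / \<delta> \<or> (y + (1 - \<delta>)) / \<delta> < -1"
    using \<delta> y by (auto simp: field_simps)
  then have "?W \<inter> {-1..1} = {}" by auto
  then have "AE x in \<mu>. x \<notin> ?W"
    by (intro eventually_mono[OF AE_in_interval[OF \<mu>]]) blast
  then have "prob ?W = 0"
    using \<mu> by (subst prob_eq_0) (auto simp: prob_measure_on_interval_def)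
  then show ?thesis by (simp add: window_density_def)
qed

theorem theorem1:
  fixes \<delta> :: real and \<sigma> \<mu> :: "real measure"
  assumes "0 < \<delta>" and "\<delta> < 1"
    and "\<sigma> = density lborel (\<lambda>\<beta>. ennreal (1 / 2 * indicator {-1..1} \<beta>))"
    and "is_invariant_measure \<delta> \<sigma> \<mu>"
  shows "absolutely_continuous lborel \<mu> \<and>
    (\<exists>\<rho> :: real \<Rightarrow> real.
       (\<forall>x. 0 \<le> \<rho> x) \<and> (\<forall>x. x \<notin> {-1..1} \<longrightarrow> \<rho> x = 0) \<and>
       \<rho> \<in> borel_measurable borel \<and>
       \<mu> = density lborel (\<lambda>x. ennreal (\<rho> x)) \<and>
       infinitely_differentiable \<rho> \<and> \<not> real_analytic \<rho>)"
proof -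
  let ?\<rho> = "window_density \<delta> \<mu>"
  have \<mu>: "prob_measure_on_interval \<mu>"
    using assms(4) by (simp add: is_invariant_measure_def)
  note M = real_distribution_on_interval[OF \<mu>]
  interpret M: real_distribution \<mu> by (rule M)
  note meas = invariant_eq_density_window(1)[OF assms]
  note dens = invariant_eq_density_window(2)[OF assms]
  note out = window_density_outside[OF assms(1,2) \<mu>]
  have "\<not> real_analytic ?\<rho>"
  proof
    assume "real_analytic ?\<rho>"
    from real_analytic_zero_right_half_line[OF this, of 1] have "?\<rho> = (\<lambda>_. 0)"
      using out by fastforce
    then have "\<mu> = density lborel (\<lambda>_. 0)"
      using dens by simp
    then have "emeasure \<mu> UNIV = 0"
      by (rule ssubst) (simp add: emeasure_density)
    then show False
      using M.emeasure_space_1 by simp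
  qed
  moreover have "absolutely_continuous lborel \<mu>"
    by (subst dens, rule absolutely_continuousI_density) (use meas in measurable)
  moreover have "0 \<le> ?\<rho> x" for x
    using assms by (simp add: window_density_def)
  ultimately show ?thesis
    using out meas dens smooth_window_density[OF assms(1,2) M dens meas] by blast
qed

end
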